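(* For every positive integer $n$, $\sigma_{od}\mathrm{meex}(n)=2\,p_{ed}(n)$.
   Context: For $n\ge 0$, $\mathcal{P}_{od}(n)$ is the set of all partitions of $n$ in which no odd part is repeated (even parts may appear with any multiplicity), and $p_{ed}(n)$ is the number of partitions of $n$ in which no even part is repeated (odd parts may appear with any multiplicity). For $\lambda\in\mathcal{P}_{od}(n)$, $\mathrm{meex}(\lambda)$ is the smallest positive even integer that is not a part of $\lambda$. Define $\sigma_{od}\mathrm{meex}(n):=\sum_{\lambda\in\mathcal{P}_{od}(n)}\mathrm{meex}(\lambda)$. *)

theory Defs
  imports Complex_Main "HOL-Library.Multiset"
begin

text \<open>An integer partition is encoded as the finite multiset of its (positive) parts.\<close>

definition partitions :: "nat \<Rightarrow> nat multiset set" where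
  "partitions n = {lam. 0 \<notin># lam \<and> sum_mset lam = n}"

definition P_od :: "nat \<Rightarrow> nat multiset set" where
  "P_od n = {lam \<in> partitions n. \<forall>k. odd k \<longrightarrow> count lam k \<le> 1}"

definition P_ed :: "nat \<Rightarrow> nat multiset set" where
  "P_ed n = {lam \<in> partitions n. \<forall>k. even k \<longrightarrow> count lam k \<le> 1}"

definition p_ed :: "nat \<Rightarrow> nat" where
  "p_ed n = card (P_ed n)"

definition meex :: "nat multiset \<Rightarrow> nat" where
  "meex lam = (LEAST m. 0 < m \<and> even m \<and> m \<notin># lam)"

definition sigma_od_meex :: "nat \<Rightarrow> nat" where
  "sigma_od_meex n = (\<Sum>lam\<in>P_od n. meex lam)"

text \<open>The sets being summed over and counted are finite, so neither \<^const>\<open>sum\<close> nor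
  \<^const>\<open>card\<close> takes its default value \<open>0\<close>.\<close>

lemma size_le_sum_mset:
  fixes M :: "nat multiset"
  assumes "0 \<notin># M"
  shows "size M \<le> sum_mset M"
  using assms by (induction M) auto

lemma finite_partitions: "finite (partitions n)"
proof (rule finite_subset)
  show "partitions n \<subseteq> mset ` {xs. set xs \<subseteq> {..n} \<and> length xs \<le> n}"
  proof
    fix M assume "M \<in> partitions n"
    then have M: "0 \<notin># M" "sum_mset M = n"
      by (auto simp: partitions_def)
    obtain xs where xs: "mset xs = M"
      using ex_mset by blast
    have "length xs \<le> n"
      using size_le_sum_mset[OF M(1)] M(2) xs by auto
    moreover have "set xs \<subseteq> {..n}"
      using M(2) xs by (auto simp: sum_mset_sum_list member_le_sum_list)
    ultimately show "M \<in> mset ` {xs. set xs \<subseteq> {..n} \<and> length xs \<le> n}"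
      using xs by blast
  qed
  show "finite (mset ` {xs. set xs \<subseteq> {..n} \<and> length xs \<le> n})"
    by (intro finite_imageI finite_lists_length_le) simp
qed

lemma finite_P_od: "finite (P_od n)" and finite_P_ed: "finite (P_ed n)"
  using finite_partitions[of n] by (auto simp: P_od_def P_ed_def)

end

theory Submission
  imports Defs "HOL-Computational_Algebra.Formal_Power_Series"
begin

text \<open>
  Since \<open>meex \<lambda> / 2\<close> counts the \<open>k \<ge> 0\<close> such that \<open>2, 4, \<dots>, 2k\<close> are all parts of \<open>\<lambda>\<close>, removing
  these parts shows that \<open>\<sigma>\<^sub>o\<^sub>d meex / 2\<close> has generating function
  \<open>\<Sum>\<^sub>k X\<^bsup>k(k+1)\<^esup> \<Prod> (1 + X\<^bsup>2i-1\<^esup>) / \<Prod> (1 - X\<^bsup>2i\<^esup>)\<close>. By the case \<open>z = q\<close> of Jacobi's triple product,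
  \<open>\<Sum>\<^sub>k X\<^bsup>k(k+1)\<^esup> = \<Prod> (1 - X\<^bsup>2i\<^esup>) (1 + X\<^bsup>2i\<^esup>)\<^sup>2\<close>, so this equals
  \<open>\<Prod> (1 + X\<^bsup>2i\<^esup>) (1 + X\<^bsup>i\<^esup>)\<close>, which is \<open>\<Prod> (1 + X\<^bsup>2i\<^esup>) / (1 - X\<^bsup>2i-1\<^esup>)\<close> by Euler's theorem on
  distinct and odd parts. All products are truncated and compared modulo a power of \<open>X\<close>;
  the triple product is replaced by its finite form, a case of the \<open>q\<close>-binomial theorem.
\<close>

section \<open>The q-binomial theorem\<close>

text \<open>The q-Pochhammer symbol \<open>(q; q)_n\<close>.\<close>

definition qpoch :: "'a::comm_ring_1 \<Rightarrow> nat \<Rightarrow> 'a" where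
  "qpoch q n = (\<Prod>i=1..n. 1 - q ^ i)"

lemma qpoch_0 [simp]: "qpoch q 0 = 1"
  by (simp add: qpoch_def)

lemma qpoch_Suc: "qpoch q (Suc n) = qpoch q n * (1 - q ^ Suc n)"
  by (simp add: qpoch_def)

lemma qpoch_split:
  assumes "m \<le> n"
  shows "qpoch q n = qpoch q m * (\<Prod>i\<in>{m<..n}. 1 - q ^ i)"
proof -
  have "{1..n} = {1..m} \<union> {m<..n}" "{1..m} \<inter> {m<..n} = {}"
    using assms by auto
  then show ?thesis
    by (simp add: qpoch_def prod.union_disjoint)
qed

text \<open>The Gaussian binomial coefficient, defined by its Pascal recurrence instead of a
  quotient, so that it makes sense in every commutative ring.\<close>

fun qbinomial :: "'a::comm_ring_1 \<Rightarrow> nat \<Rightarrow> nat \<Rightarrow> 'a" where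
  "qbinomial q m 0 = 1"
| "qbinomial q 0 (Suc j) = 0"
| "qbinomial q (Suc m) (Suc j) = qbinomial q m j + q ^ Suc j * qbinomial q m (Suc j)"

lemma qbinomial_eq_0: "m < j \<Longrightarrow> qbinomial q m j = 0"
  by (induction q m j rule: qbinomial.induct) auto

lemma qbinomial_self: "qbinomial q m m = 1"
  by (induction m) (auto simp: qbinomial_eq_0)

text \<open>The quotient formula without division. After multiplication, the two Pascal summands
  become \<open>qpoch q m\<close> times \<open>1 - q ^ j\<close> and times
  \<open>q ^ j * (1 - q ^ l)\<close>, and these add up to \<open>1 - q ^ (j + l)\<close>.\<close>

lemma qbinomial_mult_qpoch:
  "qbinomial q (j + l) j * (qpoch q j * qpoch q l) = qpoch q (j + l)"
proof (induction "j + l" arbitrary: j l)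
  case 0
  then show ?case by simp
next
  case (Suc m)
  show ?case
  proof (cases j)
    case 0
    then show ?thesis by simp
  next
    case (Suc i)
    note j = this
    show ?thesis
    proof (cases l)
      case 0
      then show ?thesis by (simp add: qbinomial_self)
    next
      case (Suc k)
      have 1: "qbinomial q m i * (qpoch q i * qpoch q l) = qpoch q m"
        using Suc.hyps(1)[of i l] Suc.hyps(2) j by simp
      have 2: "qbinomial q m j * (qpoch q j * qpoch q k) = qpoch q m"
        using Suc.hyps(1)[of j k] Suc.hyps(2) \<open>l = Suc k\<close> by simp
      have "qbinomial q (j + l) j * (qpoch q j * qpoch q l)
          = (qbinomial q m i + q ^ j * qbinomial q m j) * (qpoch q j * qpoch q l)"
        using Suc.hyps(2) j by (metis qbinomial.simps(3))
      also have "\<dots> = qbinomial q m i * (qpoch q i * qpoch q l) * (1 - q ^ j)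
          + q ^ j * (qbinomial q m j * (qpoch q j * qpoch q k)) * (1 - q ^ l)"
        unfolding j \<open>l = Suc k\<close> qpoch_Suc by (simp only: algebra_simps)
      also have "\<dots> = qpoch q m * (1 - q ^ (j + l))"
        unfolding 1 2 by (simp add: algebra_simps power_add)
      also have "\<dots> = qpoch q (j + l)"
        using Suc.hyps(2) by (metis qpoch_Suc)
      finally show ?thesis .
    qed
  qed
qed

lemma Suc_choose_two: "Suc j choose 2 = (j choose 2) + j"
  by (simp add: numeral_2_eq_2)

text \<open>Splitting off the factor \<open>y + z\<close> leaves the same product with
  \<open>z * q\<close> for \<open>z\<close>, so the induction generalises \<open>z\<close>; the
  Pascal recurrence then recombines the coefficients. The second variable \<open>y\<close> avoids
  negative powers of \<open>q\<close> in the symmetric case \<open>y = q ^ N\<close>.\<close>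

lemma qbinomial_theorem:
  fixes q y z :: "'a::comm_ring_1"
  shows "(\<Prod>i<m. y + z * q ^ i) = (\<Sum>j\<le>m. q ^ (j choose 2) * qbinomial q m j * z ^ j * y ^ (m - j))"
proof (induction m arbitrary: z)
  case 0
  then show ?case by (simp add: binomial_eq_0)
next
  case (Suc m)
  let ?t = "\<lambda>j. q ^ (j choose 2) * qbinomial q m j * (z * q) ^ j * y ^ (m - j)"
  let ?u = "\<lambda>j. q ^ (Suc j choose 2) * (q ^ Suc j * qbinomial q m (Suc j)) * z ^ Suc j * y ^ (m - j)"
  have "(\<Prod>i<Suc m. y + z * q ^ i) = (y + z) * (\<Prod>i<m. y + (z * q) * q ^ i)"
    by (subst prod.lessThan_Suc_shift) (simp add: mult.assoc)
  also have "\<dots> = y * (\<Sum>j\<le>m. ?t j) + z * (\<Sum>j\<le>m. ?t j)"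
    unfolding Suc.IH by (simp add: algebra_simps)
  \<comment> \<open>The added term is zero; it makes the index shift end at \<open>m\<close> again,
    where \<open>?t (Suc m)\<close> is harmless although \<open>m - Suc m\<close> is
    truncated.\<close>
  also have "y * (\<Sum>j\<le>m. ?t j) = y * (\<Sum>j\<le>Suc m. ?t j)"
    by (simp add: qbinomial_eq_0)
  also have "\<dots> = y ^ Suc m + (\<Sum>j\<le>m. y * ?t (Suc j))"
    by (subst sum.atMost_Suc_shift) (simp add: algebra_simps sum_distrib_left binomial_eq_0)
  also have "(\<Sum>j\<le>m. y * ?t (Suc j)) = (\<Sum>j\<le>m. ?u j)"
  proof (rule sum.cong[OF refl])
    fix j assume "j \<in> {..m}"
    show "y * ?t (Suc j) = ?u j"
    proof (cases "j = m")
      case True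
      then show ?thesis by (simp add: qbinomial_eq_0)
    next
      case False
      then have "m - j = Suc (m - Suc j)"
        using \<open>j \<in> {..m}\<close> by auto
      then show ?thesis
        by (simp add: power_mult_distrib algebra_simps)
    qed
  qed
  also have "z * (\<Sum>j\<le>m. ?t j)
      = (\<Sum>j\<le>m. q ^ (Suc j choose 2) * qbinomial q m j * z ^ Suc j * y ^ (m - j))"
    by (simp add: sum_distrib_left Suc_choose_two power_add power_mult_distrib algebra_simps)
  also have "y ^ Suc m + (\<Sum>j\<le>m. ?u j) + \<dots>
      = y ^ Suc m + (\<Sum>j\<le>m. q ^ (Suc j choose 2) * qbinomial q (Suc m) (Suc j) * z ^ Suc j * y ^ (m - j))"
    by (simp add: sum.distrib[symmetric] algebra_simps)
  also have "\<dots> = (\<Sum>j\<le>Suc m. q ^ (j choose 2) * qbinomial q (Suc m) j * z ^ j * y ^ (Suc m - j))"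
    by (subst sum.atMost_Suc_shift) (simp add: binomial_eq_0)
  finally show ?case .
qed

section \<open>Finite form of the triple product\<close>

lemma two_mult_choose_two: "2 * (j choose 2) + j = j * j"
  by (induction j) (auto simp: Suc_choose_two)

text \<open>The case \<open>y = q ^ N\<close>, \<open>z = 1\<close>, \<open>m = 2 * N + 1\<close> of the \<open>q\<close>-binomial theorem; the terms
  \<open>j = N - k\<close> and \<open>j = N + 1 + k\<close> coincide.\<close>
lemma finite_triple_product:
  fixes q :: "'a::idom"
  assumes "(2 :: 'a) \<noteq> 0" "q \<noteq> 0" and nz: "\<And>n. qpoch q n \<noteq> 0"
  shows "(\<Prod>i=1..N. 1 + q ^ i)\<^sup>2
    = (\<Sum>k\<le>N. q ^ (Suc k choose 2) * qbinomial q (2 * N + 1) (N - k))"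
proof -
  let ?B = "\<Prod>i=1..N. 1 + q ^ i"
  let ?f = "\<lambda>j. q ^ (j choose 2) * qbinomial q (2 * N + 1) j * q ^ (N * (2 * N + 1 - j))"
  \<comment> \<open>The power of \<open>q\<close> common to both sides. In the product,
    \<open>N choose 2\<close> comes from the factors with \<open>i < N\<close>, \<open>N\<close>
    from \<open>i = N\<close>, and \<open>N * N\<close> from the factors above.\<close>
  define e where "e = (N choose 2) + N + N * N"
  define S where "S = (\<Sum>k\<le>N. q ^ (Suc k choose 2) * qbinomial q (2 * N + 1) (N - k))"
  have low: "(\<Prod>i<N. q ^ N + q ^ i) = q ^ (N choose 2) * ?B"
  proof -
    have "(\<Prod>i<N. q ^ N + q ^ i) = (\<Prod>i<N. q ^ i * (1 + q ^ (N - i)))"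
      by (rule prod.cong) (auto simp: algebra_simps simp flip: power_add)
    also have "\<dots> = q ^ (\<Sum>i<N. i) * (\<Prod>i<N. 1 + q ^ (N - i))"
      by (simp add: prod.distrib power_sum)
    also have "(\<Sum>i<N. i) = N choose 2"
      by (induction N) (auto simp: Suc_choose_two)
    also have "(\<Prod>i<N. 1 + q ^ (N - i)) = ?B"
      by (rule prod.reindex_bij_witness[of _ "\<lambda>i. N - i" "\<lambda>i. N - i"]) auto
    finally show ?thesis .
  qed
  have high: "(\<Prod>i=1..N. q ^ N + q ^ (N + i)) = q ^ (N * N) * ?B"
  proof -
    have "(\<Prod>i=1..N. q ^ N + q ^ (N + i)) = (\<Prod>i=1..N. q ^ N * (1 + q ^ i))"
      by (rule prod.cong) (auto simp: algebra_simps power_add)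
    then show ?thesis
      by (simp add: prod.distrib power_mult)
  qed
  have "(\<Prod>i<2 * N + 1. q ^ N + q ^ i)
      = (\<Prod>i<N. q ^ N + q ^ i) * (\<Prod>i\<in>{N..<2 * N + 1}. q ^ N + q ^ i)"
    by (subst prod.union_disjoint[symmetric]) (auto simp del: prod.lessThan_Suc intro!: prod.cong)
  also have "(\<Prod>i\<in>{N..<2 * N + 1}. q ^ N + q ^ i)
      = 2 * q ^ N * (\<Prod>i\<in>{N<..2 * N}. q ^ N + q ^ i)"
  proof -
    have "{N..<2 * N + 1} = insert N {N<..2 * N}" by auto
    then show ?thesis by simp
  qed
  also have "(\<Prod>i\<in>{N<..2 * N}. q ^ N + q ^ i) = (\<Prod>i=1..N. q ^ N + q ^ (N + i))"
    by (rule prod.reindex_bij_witness[of _ "\<lambda>i. N + i" "\<lambda>i. i - N"]) auto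
  finally have lhs: "(\<Prod>i<2 * N + 1. q ^ N + q ^ i) = 2 * q ^ e * ?B\<^sup>2"
    unfolding low high by (simp add: e_def power_add power2_eq_square algebra_simps)

  have term_low: "?f (N - k) = q ^ e * (q ^ (Suc k choose 2) * qbinomial q (2 * N + 1) (N - k))"
    if "k \<le> N" for k
  proof -
    from that obtain d where d: "N = k + d" using le_Suc_ex by blast
    have "(d choose 2) + N * (N + 1 + k) = e + (Suc k choose 2)"
      using two_mult_choose_two[of d] two_mult_choose_two[of N] two_mult_choose_two[of k]
      unfolding e_def Suc_choose_two d by (simp add: algebra_simps)
    moreover have "N - k = d" "2 * N + 1 - d = N + 1 + k"
      using d by auto
    ultimately show ?thesis
      by (simp add: algebra_simps flip: power_add)
  qed
  \<comment> \<open>Both coefficients satisfy the same product formula; cancelling the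
    \<open>qpoch\<close> factors is where \<open>nz\<close> enters.\<close>
  have sym: "qbinomial q (2 * N + 1) (N + 1 + k) = qbinomial q (2 * N + 1) (N - k)"
    if "k \<le> N" for k
  proof -
    have "N + 1 + k + (N - k) = 2 * N + 1" "N - k + (N + 1 + k) = 2 * N + 1"
      using that by auto
    with qbinomial_mult_qpoch[of q "N + 1 + k" "N - k"] qbinomial_mult_qpoch[of q "N - k" "N + 1 + k"]
    have "qbinomial q (2 * N + 1) (N + 1 + k) * (qpoch q (N + 1 + k) * qpoch q (N - k))
      = qbinomial q (2 * N + 1) (N - k) * (qpoch q (N + 1 + k) * qpoch q (N - k))"
      by (metis mult.commute)
    then show ?thesis using nz by simp
  qed
  have term_high: "?f (N + 1 + k) = ?f (N - k)" if "k \<le> N" for k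
  proof -
    from that obtain d where d: "N = k + d" using le_Suc_ex by blast
    have "(N + 1 + k choose 2) + N * d = (d choose 2) + N * (N + 1 + k)"
      using two_mult_choose_two[of d] two_mult_choose_two[of "N + 1 + k"]
      unfolding d by (simp add: algebra_simps)
    moreover have "N - k = d" "2 * N + 1 - d = N + 1 + k" "2 * N + 1 - (N + 1 + k) = d"
      using d by auto
    ultimately show ?thesis
      using sym[OF that] by (simp add: mult.assoc mult.left_commute flip: power_add)
  qed
  have "(\<Prod>i<2 * N + 1. q ^ N + q ^ i) = (\<Sum>j\<le>2 * N + 1. ?f j)"
    using qbinomial_theorem[of "q ^ N" 1 q "2 * N + 1"] by (simp flip: power_mult)
  also have "\<dots> = (\<Sum>j\<le>N. ?f j) + (\<Sum>j\<in>{N<..2 * N + 1}. ?f j)"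
    by (subst sum.union_disjoint[symmetric]) (auto simp del: sum.atMost_Suc intro!: sum.cong)
  also have "(\<Sum>j\<le>N. ?f j) = (\<Sum>k\<le>N. ?f (N - k))"
    by (rule sum.reindex_bij_witness[of _ "\<lambda>i. N - i" "\<lambda>i. N - i"]) auto
  also have "(\<Sum>j\<in>{N<..2 * N + 1}. ?f j) = (\<Sum>k\<le>N. ?f (N + 1 + k))"
    by (rule sum.reindex_bij_witness[of _ "\<lambda>k. N + 1 + k" "\<lambda>j. j - (N + 1)"]) auto
  also have "\<dots> = (\<Sum>k\<le>N. ?f (N - k))"
    by (rule sum.cong[OF refl], rule term_high) simp
  also have "(\<Sum>k\<le>N. ?f (N - k)) = q ^ e * S"
    unfolding S_def sum_distrib_left by (rule sum.cong[OF refl], rule term_low) simp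
  \<comment> \<open>The left factor 2 is the middle factor \<open>q ^ N + q ^ N\<close>; the right
    one counts the two equal halves of the sum.\<close>
  finally have "2 * q ^ e * ?B\<^sup>2 = 2 * q ^ e * S"
    using lhs by (simp only: mult_2 distrib_right)
  then show ?thesis
    using assms(1,2) by (simp add: S_def)
qed

section \<open>Truncated product identities\<close>

text \<open>The truncation device: a tail of a product whose factors are all 1 modulo a power of
  \<open>q\<close> may be dropped modulo that power.\<close>

lemma dvd_prod_minus_one:
  fixes d :: "'a::comm_ring_1"
  assumes "\<And>i. i \<in> I \<Longrightarrow> d dvd f i - 1"
  shows "d dvd (\<Prod>i\<in>I. f i) - 1"
  using assms
proof (induction I rule: infinite_finite_induct)
  case (insert i I)
  have "(\<Prod>i\<in>insert i I. f i) - 1 = f i * ((\<Prod>i\<in>I. f i) - 1) + (f i - 1)"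
    using insert.hyps by (simp add: algebra_simps)
  then show ?case
    using insert by (metis dvd_add dvd_mult insert_iff)
qed auto

lemma fps_dvd_mult_cancel:
  fixes d u f :: "'a::field fps"
  assumes "fps_nth u 0 \<noteq> 0" "d dvd u * f"
  shows "d dvd f"
proof -
  have "f = inverse u * (u * f)"
    using inverse_mult_eq_1[OF assms(1)] by (simp flip: mult.assoc)
  then show ?thesis using assms(2) by (metis dvd_mult)
qed

lemma fps_prod_nth_0: "fps_nth (\<Prod>i\<in>I. f i) 0 = (\<Prod>i\<in>I. fps_nth (f i) 0)"
  by (induction I rule: infinite_finite_induct) auto

text \<open>The finite triple product is multiplied by \<open>qpoch q N\<close>. Each Gaussian
  binomial then becomes 1 up to an error that its own power of \<open>q\<close> makes
  negligible.\<close>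

lemma gauss_triangular_mod:
  fixes N :: nat
  defines "q \<equiv> (fps_X :: rat fps)\<^sup>2"
  shows "fps_X ^ (2 * N + 2) dvd
    qpoch q N * (\<Prod>i=1..N. 1 + q ^ i)\<^sup>2 - (\<Sum>k\<le>N. fps_X ^ (k * (k + 1)))"
proof -
  have unit: "fps_nth (qpoch q n) 0 = 1" for n
    by (auto simp: qpoch_def fps_prod_nth_0 q_def simp flip: power_mult intro!: prod.neutral)
  then have nz: "qpoch q n \<noteq> 0" for n
    by (metis fps_zero_nth zero_neq_one)
  have q_dvd: "q ^ m dvd (1 - q ^ i) - 1" if "m \<le> i" for m i
    using that by (simp add: le_imp_power_dvd)
  have "q ^ (N + 1) dvd q ^ (Suc k choose 2) * (qbinomial q (2 * N + 1) (N - k) * qpoch q N - 1)"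
    if "k \<le> N" for k
  proof -
    \<comment> \<open>\<open>R\<close> and \<open>S\<close> are tails of \<open>qpoch\<close>
      products: the Gaussian binomial times \<open>qpoch q N\<close> equals \<open>S * R\<close>,
      and all exponents of \<open>q\<close> in both exceed \<open>N - k\<close>.\<close>
    define R where "R = (\<Prod>i\<in>{N - k<..N}. 1 - q ^ i)"
    define S where "S = (\<Prod>i\<in>{N + 1 + k<..2 * N + 1}. 1 - q ^ i)"
    have "qbinomial q (2 * N + 1) (N - k) * (qpoch q (N - k) * qpoch q (N + 1 + k)) = qpoch q (2 * N + 1)"
      using qbinomial_mult_qpoch[of q "N - k" "N + 1 + k"] that by (simp add: mult_2)
    also have "\<dots> = qpoch q (N + 1 + k) * S"
      unfolding S_def using that by (intro qpoch_split) auto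
    finally have "qbinomial q (2 * N + 1) (N - k) * qpoch q (N - k) = S"
      using nz[of "N + 1 + k"] by (metis mult.assoc mult.commute mult_left_cancel)
    moreover have "qpoch q N = qpoch q (N - k) * R"
      unfolding R_def by (intro qpoch_split) auto
    ultimately have "qbinomial q (2 * N + 1) (N - k) * qpoch q N - 1 = (S - 1) * R + (R - 1)"
      by (simp add: algebra_simps)
    moreover have "q ^ (N - k + 1) dvd R - 1" "q ^ (N - k + 1) dvd S - 1"
      unfolding R_def S_def by (intro dvd_prod_minus_one q_dvd; auto)+
    ultimately have "q ^ (N - k + 1) dvd qbinomial q (2 * N + 1) (N - k) * qpoch q N - 1"
      by (metis dvd_add dvd_mult2)
    \<comment> \<open>The missing \<open>q ^ k\<close> is available because
      \<open>Suc k choose 2\<close> is at least \<open>k\<close>.\<close>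
    then have "q ^ k * q ^ (N - k + 1)
        dvd q ^ (Suc k choose 2) * (qbinomial q (2 * N + 1) (N - k) * qpoch q N - 1)"
      by (intro mult_dvd_mono le_imp_power_dvd) (simp_all add: Suc_choose_two)
    moreover have "q ^ k * q ^ (N - k + 1) = q ^ (N + 1)"
      unfolding power_add[symmetric] using that by simp
    ultimately show ?thesis
      by (simp only:)
  qed
  moreover have two_nz: "(2 :: rat fps) \<noteq> 0"
    by (simp add: numeral_fps_const)
  ultimately have "q ^ (N + 1) dvd
      (\<Sum>k\<le>N. q ^ (Suc k choose 2) * (qbinomial q (2 * N + 1) (N - k) * qpoch q N - 1))"
    by (intro dvd_sum) auto
  also have "\<dots> = qpoch q N * (\<Prod>i=1..N. 1 + q ^ i)\<^sup>2 - (\<Sum>k\<le>N. q ^ (Suc k choose 2))"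
    using finite_triple_product[OF two_nz _ nz, of N]
    by (simp add: q_def algebra_simps sum_subtractf sum_distrib_left)
  finally have "q ^ (N + 1) dvd
      qpoch q N * (\<Prod>i=1..N. 1 + q ^ i)\<^sup>2 - (\<Sum>k\<le>N. q ^ (Suc k choose 2))" .
  moreover have "(\<Sum>k\<le>N. q ^ (Suc k choose 2)) = (\<Sum>k\<le>N. fps_X ^ (k * (k + 1)))"
  proof (rule sum.cong[OF refl])
    fix k
    have "2 * (Suc k choose 2) = k * (k + 1)"
      using two_mult_choose_two[of k] by (simp add: Suc_choose_two)
    then show "q ^ (Suc k choose 2) = fps_X ^ (k * (k + 1))"
      unfolding q_def by (metis power_mult)
  qed
  moreover have "q ^ (N + 1) = fps_X ^ (2 * N + 2)"
    unfolding q_def power_mult[symmetric] by simp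
  ultimately show ?thesis
    by (simp only:)
qed

lemma atLeastAtMost_double:
  "{1..2 * N} = (\<lambda>i. 2 * i) ` {1..N} \<union> (\<lambda>i. 2 * i - 1) ` {1..N::nat}"
proof -
  have "x \<in> (\<lambda>i. 2 * i) ` {1..N} \<union> (\<lambda>i. 2 * i - 1) ` {1..N}" if "x \<in> {1..2 * N}" for x
  proof (cases "even x")
    case True
    then show ?thesis using that by (auto elim!: evenE)
  next
    case False
    then obtain i where "x = 2 * i + 1" by (elim oddE)
    then show ?thesis using that by (auto intro!: image_eqI[of _ _ "Suc i"])
  qed
  then have "{1..2 * N} \<subseteq> (\<lambda>i. 2 * i) ` {1..N} \<union> (\<lambda>i. 2 * i - 1) ` {1..N}"
    by blast
  then show ?thesis
    by (rule equalityI) auto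
qed

lemma prod_even_odd:
  fixes f :: "nat \<Rightarrow> 'a::comm_monoid_mult"
  shows "(\<Prod>i=1..2 * N. f i) = (\<Prod>i=1..N. f (2 * i)) * (\<Prod>i=1..N. f (2 * i - 1))"
  by (induction N) (simp_all add: mult_ac)

text \<open>Since \<open>(1 + X^i) (1 - X^i) = 1 - X^(2i)\<close>, supplying the even factors
  \<open>qpoch q N\<close> turns the product into \<open>qpoch q (2 * N)\<close>. Cancelling them
  leaves the tail \<open>R\<close>, which is 1 modulo \<open>q ^ (N + 1)\<close>.\<close>

lemma euler_distinct_odd_mod:
  "(fps_X :: rat fps) ^ (2 * N + 2) dvd
    (\<Prod>i=1..2 * N. 1 + fps_X ^ i) * (\<Prod>i=1..N. 1 - fps_X ^ (2 * i - 1)) - 1"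
proof -
  define q :: "rat fps" where "q = fps_X\<^sup>2"
  define D :: "rat fps" where "D = (\<Prod>i=1..2 * N. 1 + fps_X ^ i)"
  define O' :: "rat fps" where "O' = (\<Prod>i=1..N. 1 - fps_X ^ (2 * i - 1))"
  define R where "R = (\<Prod>i\<in>{N<..2 * N}. 1 - q ^ i)"
  have unit: "fps_nth (qpoch q N) 0 = 1"
    by (auto simp: qpoch_def fps_prod_nth_0 q_def simp flip: power_mult intro!: prod.neutral)
  have "D * (qpoch q N * O') = D * (\<Prod>i=1..2 * N. 1 - fps_X ^ i)"
    unfolding prod_even_odd[of "\<lambda>i. 1 - fps_X ^ i"] by (simp add: qpoch_def O'_def q_def power_mult)
  also have "\<dots> = qpoch q (2 * N)"
    unfolding D_def qpoch_def prod.distrib[symmetric]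
    by (rule prod.cong[OF refl])
       (simp add: q_def algebra_simps power2_eq_square power_mult_distrib)
  also have "\<dots> = qpoch q N * R"
    unfolding R_def by (intro qpoch_split) auto
  finally have "qpoch q N * (D * O') = qpoch q N * R"
    by (simp add: mult_ac)
  moreover have "qpoch q N \<noteq> 0"
    using unit by (metis fps_zero_nth zero_neq_one)
  ultimately have "D * O' = R" by simp
  moreover have "q ^ (N + 1) = fps_X ^ (2 * N + 2)"
    unfolding q_def power_mult[symmetric] by simp
  moreover have "q ^ (N + 1) dvd R - 1"
    unfolding R_def by (intro dvd_prod_minus_one) (auto simp: Suc_le_eq simp del: power_Suc intro!: le_imp_power_dvd)
  ultimately show ?thesis
    by (simp only: D_def O'_def)
qed

section \<open>Generating functions of partitions\<close>

text \<open>With \<open>S = {1..M}\<close> and \<open>D\<close> the odd or the even numbers, this is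
  \<open>P_od n\<close> or \<open>P_ed n\<close> for \<open>n \<le> M\<close>, while a finite
  \<open>S\<close> keeps the generating function a finite product.\<close>

definition restricted_partitions :: "nat set \<Rightarrow> nat set \<Rightarrow> nat \<Rightarrow> nat multiset set" where
  "restricted_partitions S D n =
    {lam. set_mset lam \<subseteq> S \<and> sum_mset lam = n \<and> (\<forall>k\<in>D. count lam k \<le> 1)}"

definition restricted_gf :: "nat set \<Rightarrow> nat set \<Rightarrow> rat fps" where
  "restricted_gf S D = Abs_fps (\<lambda>n. of_nat (card (restricted_partitions S D n)))"

lemma finite_restricted_partitions:
  assumes "0 \<notin> S"
  shows "finite (restricted_partitions S D n)"
  using assms by (intro finite_subset[OF _ finite_partitions[of n]])
    (auto simp: restricted_partitions_def partitions_def)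

lemma restricted_gf_empty: "restricted_gf {} D = 1"
proof (rule fps_ext)
  fix n
  have "restricted_partitions {} D n = (if n = 0 then {{#}} else {})"
    by (auto simp: restricted_partitions_def)
  then show "fps_nth (restricted_gf {} D) n = fps_nth 1 n"
    by (simp add: restricted_gf_def)
qed

text \<open>Partitions are split by whether \<open>i\<close> occurs. \<open>T m\<close> is what
  remains after one copy of \<open>i\<close> is removed; only this set differs between distinct and
  repeatable parts.\<close>

lemma restricted_gf_insert_aux:
  assumes "0 \<notin> S" "i \<notin> S" "0 < i"
    and T: "\<And>m. {lam \<in> restricted_partitions (insert i S) D (i + m). i \<in># lam} = add_mset i ` T m"
  shows "restricted_gf (insert i S) D
    = restricted_gf S D + fps_X ^ i * Abs_fps (\<lambda>n. of_nat (card (T n)))"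
proof (rule fps_ext)
  fix n
  let ?A = "restricted_partitions (insert i S) D n"
  have fin: "finite ?A"
    using assms by (intro finite_restricted_partitions) auto
  have "?A = {lam \<in> ?A. i \<notin># lam} \<union> {lam \<in> ?A. i \<in># lam}" by auto
  then have "card ?A = card {lam \<in> ?A. i \<notin># lam} + card {lam \<in> ?A. i \<in># lam}"
    using fin by (metis (no_types, lifting) card_Un_disjoint disjoint_iff finite_Un mem_Collect_eq)
  moreover have "{lam \<in> ?A. i \<notin># lam} = restricted_partitions S D n"
    using assms by (auto simp: restricted_partitions_def)
  moreover have "card {lam \<in> ?A. i \<in># lam} = (if i \<le> n then card (T (n - i)) else 0)"
  proof (cases "i \<le> n")
    case True
    then have "{lam \<in> ?A. i \<in># lam} = add_mset i ` T (n - i)"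
      using T[of "n - i"] by simp
    then show ?thesis
      using True by (simp add: card_image inj_on_def)
  next
    case False
    then have none: "{lam \<in> ?A. i \<in># lam} = {}"
      by (auto simp: restricted_partitions_def dest!: multi_member_split)
    show ?thesis unfolding none using False by simp
  qed
  ultimately show "fps_nth (restricted_gf (insert i S) D) n
    = fps_nth (restricted_gf S D + fps_X ^ i * Abs_fps (\<lambda>n. of_nat (card (T n)))) n"
    by (auto simp: restricted_gf_def fps_X_power_mult_nth)
qed

lemma restricted_gf_insert_distinct:
  assumes "0 \<notin> S" "i \<notin> S" "0 < i" "i \<in> D"
  shows "restricted_gf (insert i S) D = restricted_gf S D * (1 + fps_X ^ i)"
proof -
  have "{lam \<in> restricted_partitions (insert i S) D (i + m). i \<in># lam}
      = add_mset i ` restricted_partitions S D m" for m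
  proof (intro equalityI subsetI)
    fix lam assume "lam \<in> {lam \<in> restricted_partitions (insert i S) D (i + m). i \<in># lam}"
    then have lam: "set_mset lam \<subseteq> insert i S" "sum_mset lam = i + m" "\<forall>k\<in>D. count lam k \<le> 1" "i \<in># lam"
      by (auto simp: restricted_partitions_def)
    then obtain mu where mu: "lam = add_mset i mu"
      by (meson multi_member_split)
    have "i \<notin># mu"
      using lam(3) \<open>i \<in> D\<close> unfolding mu by (auto simp: not_in_iff dest!: bspec[of D _ i])
    moreover have "count mu k \<le> 1" if "k \<in> D" for k
      using lam(3) that unfolding mu by (auto split: if_splits simp: not_in_iff dest!: bspec[of D _ k])
    ultimately show "lam \<in> add_mset i ` restricted_partitions S D m"
      using lam unfolding mu by (auto simp: restricted_partitions_def)
  qed (use assms in \<open>auto simp: restricted_partitions_def not_in_iff subset_iff\<close>)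
  from restricted_gf_insert_aux[OF assms(1-3) this] show ?thesis
    by (simp add: algebra_simps flip: restricted_gf_def)
qed

text \<open>Removing one copy of a repeatable part stays in the same class, so the generating
  function \<open>F\<close> satisfies \<open>F = G + X^i F\<close>, with \<open>G\<close> the one
  for \<open>S\<close>.\<close>

lemma restricted_gf_insert_free:
  assumes "0 \<notin> S" "i \<notin> S" "0 < i" "i \<notin> D"
  shows "restricted_gf (insert i S) D * (1 - fps_X ^ i) = restricted_gf S D"
proof -
  have "{lam \<in> restricted_partitions (insert i S) D (i + m). i \<in># lam}
      = add_mset i ` restricted_partitions (insert i S) D m" for m
  proof (intro equalityI subsetI)
    fix lam assume "lam \<in> {lam \<in> restricted_partitions (insert i S) D (i + m). i \<in># lam}"
    then have lam: "set_mset lam \<subseteq> insert i S" "sum_mset lam = i + m" "\<forall>k\<in>D. count lam k \<le> 1" "i \<in># lam"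
      by (auto simp: restricted_partitions_def)
    then obtain mu where mu: "lam = add_mset i mu"
      by (meson multi_member_split)
    have "count mu k \<le> 1" if "k \<in> D" for k
      using lam(3) that unfolding mu by (auto split: if_splits simp: not_in_iff dest!: bspec[of D _ k])
    then show "lam \<in> add_mset i ` restricted_partitions (insert i S) D m"
      using lam unfolding mu by (auto simp: restricted_partitions_def)
  qed (use assms in \<open>auto simp: restricted_partitions_def\<close>)
  from restricted_gf_insert_aux[OF assms(1-3) this]
  have "restricted_gf (insert i S) D = restricted_gf S D + fps_X ^ i * restricted_gf (insert i S) D"
    by (simp flip: restricted_gf_def)
  then show ?thesis
    by (simp add: algebra_simps)
qed

lemma restricted_gf_product:
  assumes "finite S" "0 \<notin> S"
  shows "restricted_gf S D * (\<Prod>i\<in>S - D. 1 - fps_X ^ i) = (\<Prod>i\<in>S \<inter> D. 1 + fps_X ^ i)"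
  using assms
proof (induction S rule: finite_induct)
  case empty
  then show ?case by (simp add: restricted_gf_empty)
next
  case (insert i S)
  then have IH: "restricted_gf S D * (\<Prod>i\<in>S - D. 1 - fps_X ^ i) = (\<Prod>i\<in>S \<inter> D. 1 + fps_X ^ i)"
    and i: "0 \<notin> S" "0 < i" by auto
  show ?case
  proof (cases "i \<in> D")
    case True
    have "restricted_gf (insert i S) D * (\<Prod>i\<in>insert i S - D. 1 - fps_X ^ i)
        = restricted_gf S D * (\<Prod>i\<in>S - D. 1 - fps_X ^ i) * (1 + fps_X ^ i)"
      using restricted_gf_insert_distinct[OF i(1) insert.hyps(2) i(2) True] True
      by (simp add: insert_Diff_if mult_ac)
    then show ?thesis
      using IH True insert.hyps by (simp add: mult_ac)
  next
    case False
    have "restricted_gf (insert i S) D * (\<Prod>i\<in>insert i S - D. 1 - fps_X ^ i)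
        = restricted_gf (insert i S) D * (1 - fps_X ^ i) * (\<Prod>i\<in>S - D. 1 - fps_X ^ i)"
      using False insert.hyps by (simp add: insert_Diff_if mult_ac)
    then show ?thesis
      using IH False restricted_gf_insert_free[OF i(1) insert.hyps(2) i(2) False] by simp
  qed
qed

section \<open>Comparison of coefficients\<close>

lemma partitions_bounded:
  assumes "n \<le> M"
  shows "partitions n = {lam. set_mset lam \<subseteq> {1..M} \<and> sum_mset lam = n}"
proof -
  have "x \<le> sum_mset lam" if "x \<in># lam" for x and lam :: "nat multiset"
    using that by (auto dest!: multi_member_split)
  then show ?thesis
    using assms unfolding partitions_def
    by (auto simp: subset_iff Suc_le_eq) (metis gr0I, metis order_trans)
qed

lemma nth_restricted_gf_odd:
  "n \<le> M \<Longrightarrow> fps_nth (restricted_gf {1..M} {k. odd k}) n = of_nat (card (P_od n))"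
  unfolding restricted_gf_def restricted_partitions_def P_od_def
  by (auto simp: partitions_bounded intro!: arg_cong[where f = card])

lemma nth_restricted_gf_even:
  "n \<le> M \<Longrightarrow> fps_nth (restricted_gf {1..M} {k. even k}) n = of_nat (p_ed n)"
  unfolding restricted_gf_def restricted_partitions_def P_ed_def p_ed_def
  by (auto simp: partitions_bounded intro!: arg_cong[where f = card])

lemma atLeastAtMost_double_even: "{1..2 * N} \<inter> {k. even k} = (\<lambda>i. 2 * i) ` {1..N::nat}"
  unfolding atLeastAtMost_double by auto

lemma atLeastAtMost_double_odd: "{1..2 * N} \<inter> {k. odd k} = (\<lambda>i. 2 * i - 1) ` {1..N::nat}"
  unfolding atLeastAtMost_double by auto

lemma prod_evens: "(\<Prod>i\<in>{1..2 * N} \<inter> {k. even k}. f i) = (\<Prod>i=1..N. f (2 * i :: nat))"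
  unfolding atLeastAtMost_double_even by (subst prod.reindex) (auto simp: inj_on_def)

lemma prod_odds: "(\<Prod>i\<in>{1..2 * N} \<inter> {k. odd k}. f i) = (\<Prod>i=1..N. f (2 * i - 1 :: nat))"
  unfolding atLeastAtMost_double_odd by (subst prod.reindex) (auto simp: inj_on_def)

text \<open>This is the coefficient of \<open>X^n\<close> in \<Theta> \<open>* od = ed\<close>,
  which holds modulo \<open>X^(2n+2)\<close>; parts up to \<open>2 * n\<close> suffice for that
  coefficient.\<close>

lemma sum_P_od_eq_p_ed:
  "(\<Sum>k\<le>n. if k * (k + 1) \<le> n then card (P_od (n - k * (k + 1))) else 0) = p_ed n"
proof -
  define q :: "rat fps" where "q = fps_X\<^sup>2"
  define M where "M = 2 * n + 2"
  define od where "od = restricted_gf {1..2 * n} {k. odd k}"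
  define ed where "ed = restricted_gf {1..2 * n} {k. even k}"
  define A :: "rat fps" where "A = (\<Prod>i=1..n. 1 + fps_X ^ (2 * i - 1))"
  define B where "B = (\<Prod>i=1..n. 1 + q ^ i)"
  define C :: "rat fps" where "C = (\<Prod>i=1..n. 1 - fps_X ^ (2 * i - 1))"
  define P where "P = qpoch q n"
  define \<Theta> :: "rat fps" where "\<Theta> = (\<Sum>k\<le>n. fps_X ^ (k * (k + 1)))"

  have "{1..2 * n} - {k. odd k} = {1..2 * n} \<inter> {k. even k}"
    "{1..2 * n} - {k. even k} = {1..2 * n} \<inter> {k. odd k}" by auto
  then have od: "od * P = A" and ed: "ed * C = B"
    using restricted_gf_product[of "{1..2 * n}" "{k. odd k}"]
      restricted_gf_product[of "{1..2 * n}" "{k. even k}"]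
    unfolding od_def ed_def A_def B_def C_def P_def q_def qpoch_def
    by (simp_all only: prod_evens prod_odds power_mult finite_atLeastAtMost) auto
  have unit: "fps_nth (P * C) 0 \<noteq> 0"
    by (simp add: P_def C_def qpoch_def fps_prod_nth_0 q_def flip: power_mult)
  have tri: "fps_X ^ M dvd P * B\<^sup>2 - \<Theta>"
    using gauss_triangular_mod[of n] by (simp add: M_def P_def B_def \<Theta>_def q_def)
  have "(\<Prod>i=1..2 * n. 1 + fps_X ^ i) = B * A"
    unfolding prod_even_odd[of "\<lambda>i. 1 + fps_X ^ i"] by (simp add: B_def A_def q_def power_mult)
  then have euler: "fps_X ^ M dvd B * A * C - 1"
    using euler_distinct_odd_mod[of n] by (simp add: M_def C_def)
  \<comment> \<open>Multiplying by the unit \<open>P * C\<close> replaces \<open>od\<close> and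
    \<open>ed\<close> by products; the difference is then a combination of the Gauss and Euler
    congruences.\<close>
  have "P * C * (\<Theta> * od - ed) = \<Theta> * (od * P) * C - P * (ed * C)"
    by (simp add: algebra_simps)
  also have "\<dots> = P * B * (B * A * C - 1) - (P * B\<^sup>2 - \<Theta>) * (A * C)"
    unfolding od ed by (simp add: algebra_simps power2_eq_square)
  finally have "fps_X ^ M dvd P * C * (\<Theta> * od - ed)"
    using tri euler by (metis dvd_diff dvd_mult dvd_mult2)
  then have "fps_X ^ M dvd \<Theta> * od - ed"
    using unit by (rule fps_dvd_mult_cancel[rotated])
  then obtain h where "\<Theta> * od - ed = fps_X ^ M * h" by (elim dvdE)
  then have "fps_nth (\<Theta> * od - ed) n = 0"
    by (simp only: fps_X_power_mult_nth) (simp add: M_def)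
  then have "fps_nth (\<Theta> * od) n = of_nat (p_ed n)"
    using nth_restricted_gf_even[of n "2 * n"] by (simp add: ed_def)
  moreover have "fps_nth (\<Theta> * od) n
      = of_nat (\<Sum>k\<le>n. if k * (k + 1) \<le> n then card (P_od (n - k * (k + 1))) else 0)"
    unfolding \<Theta>_def sum_distrib_right fps_sum_nth of_nat_sum
    by (rule sum.cong[OF refl]) (simp add: fps_X_power_mult_nth od_def nth_restricted_gf_odd[unfolded One_nat_def])
  ultimately show ?thesis
    by (simp only: of_nat_eq_iff)
qed

section \<open>The minimal even excludant\<close>

definition even_staircase :: "nat \<Rightarrow> nat multiset" where
  "even_staircase k = mset_set ((\<lambda>i. 2 * i) ` {1..k})"

lemma sum_even_staircase: "sum_mset (even_staircase k) = k * (k + 1)"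
proof (induction k)
  case (Suc k)
  have "even_staircase (Suc k) = add_mset (2 * Suc k) (even_staircase k)"
    unfolding even_staircase_def by (simp add: atLeastAtMostSuc_conv image_iff)
  then show ?case using Suc by simp
qed (simp add: even_staircase_def)

lemma even_staircase_subseteq_iff:
  "even_staircase k \<subseteq># lam \<longleftrightarrow> (\<forall>j\<in>{1..k}. 2 * j \<in># lam)"
proof -
  have "even_staircase k \<subseteq># lam \<longleftrightarrow> (\<forall>x. x \<in> (\<lambda>i. 2 * i) ` {1..k} \<longrightarrow> 1 \<le> count lam x)"
    by (auto simp: even_staircase_def subseteq_mset_def count_mset_set')
  also have "\<dots> \<longleftrightarrow> (\<forall>j\<in>{1..k}. 2 * j \<in># lam)"
    by (auto simp: Suc_le_eq)
  finally show ?thesis .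
qed

text \<open>The \<open>LEAST\<close> in \<open>meex\<close> is attained: a multiset is finite, so
  some even number lies beyond all its elements.\<close>

lemma even_meex: "even (meex lam)"
  and meex_notin: "meex lam \<notin># lam"
  and meex_pos: "0 < meex lam"
proof -
  obtain b where b: "\<And>x. x \<in># lam \<Longrightarrow> x < b"
    using finite_nat_set_iff_bounded[of "set_mset lam"] by auto
  have "2 * Suc b \<notin># lam"
    using b[of "2 * Suc b"] by auto
  then have "0 < meex lam \<and> even (meex lam) \<and> meex lam \<notin># lam"
    using LeastI[of "\<lambda>m. 0 < m \<and> even m \<and> m \<notin># lam" "2 * Suc b"] unfolding meex_def by simp
  then show "even (meex lam)" "meex lam \<notin># lam" "0 < meex lam" by auto
qed

lemma even_staircase_subseteq_iff_less_meex:
  "even_staircase k \<subseteq># lam \<longleftrightarrow> 2 * k < meex lam"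
proof
  assume sub: "even_staircase k \<subseteq># lam"
  obtain j where j: "meex lam = 2 * j"
    using even_meex by (metis evenE)
  show "2 * k < meex lam"
  proof (rule ccontr)
    assume "\<not> 2 * k < meex lam"
    then have "j \<in> {1..k}"
      using meex_pos[of lam] j by auto
    then show False
      using sub meex_notin[of lam] j by (auto simp: even_staircase_subseteq_iff)
  qed
next
  assume "2 * k < meex lam"
  then have "2 * j \<in># lam" if "j \<in> {1..k}" for j
    using that not_less_Least[of "2 * j" "\<lambda>m. 0 < m \<and> even m \<and> m \<notin># lam"]
    by (auto simp: meex_def)
  then show "even_staircase k \<subseteq># lam"
    by (simp add: even_staircase_subseteq_iff)
qed

text \<open>Adding the staircase is injective and changes only even multiplicities, so membership in
  \<open>P_od\<close> is preserved both ways and the sum shifts by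
  \<open>k * (k + 1)\<close>.\<close>

lemma card_P_od_staircase:
  "card {lam \<in> P_od n. even_staircase k \<subseteq># lam}
    = (if k * (k + 1) \<le> n then card (P_od (n - k * (k + 1))) else 0)"
proof (cases "k * (k + 1) \<le> n")
  case True
  have zero: "0 \<notin># even_staircase k" and odd: "\<And>j. odd j \<Longrightarrow> count (even_staircase k) j = 0"
    by (auto simp: even_staircase_def count_mset_set')
  have iff: "even_staircase k + mu \<in> P_od n \<longleftrightarrow> mu \<in> P_od (n - k * (k + 1))" for mu
    using True zero odd by (auto simp: P_od_def partitions_def sum_even_staircase)
  have "{lam \<in> P_od n. even_staircase k \<subseteq># lam}
      = (\<lambda>mu. even_staircase k + mu) ` P_od (n - k * (k + 1))"
    using iff by (auto simp: mset_subset_eq_exists_conv)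
  then show ?thesis
    using True by (simp add: card_image inj_on_def)
next
  case False
  have "\<not> even_staircase k \<subseteq># lam" if "lam \<in> P_od n" for lam
  proof
    assume "even_staircase k \<subseteq># lam"
    then have "sum_mset (even_staircase k) \<le> sum_mset lam"
      by (auto simp: mset_subset_eq_exists_conv)
    then show False
      using that False by (simp add: sum_even_staircase P_od_def partitions_def)
  qed
  then have none: "{lam \<in> P_od n. even_staircase k \<subseteq># lam} = {}" by auto
  show ?thesis
    unfolding none using False by simp
qed

text \<open>If \<open>meex lam = 2 * r\<close>, the contained staircases are those with
  \<open>k < r\<close>, including the empty one \<open>k = 0\<close>. The bound
  \<open>k \<le> n\<close> loses none, as a contained staircase has sum at most
  \<open>n\<close>.\<close>

lemma meex_eq_sum:
  assumes "lam \<in> partitions n"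
  shows "meex lam = 2 * (\<Sum>k\<le>n. if even_staircase k \<subseteq># lam then 1 else 0)"
proof -
  obtain r where r: "meex lam = 2 * r"
    using even_meex by (metis evenE)
  have "k \<le> n" if "even_staircase k \<subseteq># lam" for k
  proof -
    have "k * (k + 1) \<le> sum_mset lam"
      using that by (auto simp: mset_subset_eq_exists_conv sum_even_staircase)
    then show ?thesis
      using assms by (auto simp: partitions_def)
  qed
  then have "{k. k \<le> n \<and> even_staircase k \<subseteq># lam} = {..<r}"
    by (auto simp: even_staircase_subseteq_iff_less_meex r)
  moreover have "(\<Sum>k\<le>n. if even_staircase k \<subseteq># lam then 1 else 0)
      = card {k. k \<le> n \<and> even_staircase k \<subseteq># lam}"
    by (simp flip: sum.inter_filter)
  ultimately show ?thesis
    using r by simp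
qed

theorem theorem1p5:
  fixes n :: nat
  assumes "n > 0"
  shows "sigma_od_meex n = 2 * p_ed n"
proof -
  have "sigma_od_meex n
      = (\<Sum>lam\<in>P_od n. 2 * (\<Sum>k\<le>n. if even_staircase k \<subseteq># lam then 1 else 0))"
    unfolding sigma_od_meex_def by (rule sum.cong[OF refl], rule meex_eq_sum) (simp add: P_od_def)
  \<comment> \<open>Double counting: for each \<open>k\<close>, the inner sum counts the partitions
    containing the staircase.\<close>
  also have "\<dots> = 2 * (\<Sum>k\<le>n. \<Sum>lam\<in>P_od n. if even_staircase k \<subseteq># lam then 1 else 0)"
    by (subst sum.swap) (simp only: sum_distrib_left)
  also have "\<dots> = 2 * (\<Sum>k\<le>n. card {lam \<in> P_od n. even_staircase k \<subseteq># lam})"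
    by (simp add: finite_P_od flip: sum.inter_filter)
  also have "\<dots> = 2 * p_ed n"
    unfolding card_P_od_staircase sum_P_od_eq_p_ed ..
  finally show ?thesis .
qed

end
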